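(* The Lempel-Ziv 77 factorization without self-references ($\mathsf{LZN}$, with size $\mathsf{zn}$) is non-monotonic, and the Lempel-Ziv 77 factorization with self-references ($\mathsf{LZS}$, with size $\mathsf{zs}$) is non-monotonic.
   Context: Strings are indexed from $1$; they are over arbitrary finite alphabets (no bound on the alphabet size). $S[i..j]$ is the substring from position $i$ to $j$ (empty if $j<i$), and $S[i..]=S[i..|S|]$. $\mathsf{lcp}(X,Y)$ is the length of the longest common prefix of $X$ and $Y$. Monotonicity: for a compression algorithm $\mathsf{A}$ let $\mathsf{A}(S)$ be the size of its compressed representation of $S$. $\mathsf{A}$ is monotonic if for every string $S$: $\mathsf{A}(S[1..j])\le \mathsf{A}(S)$ for all $1\le j<|S|$ and $\mathsf{A}(S[i..|S|])\le\mathsf{A}(S)$ for all $1<i\le|S|$. It is non-monotonic otherwise. Non self-referencing LZ77: $\mathsf{LZN}(S)$ is the factorization $S=f_1\cdots f_{z}$ defined greedily from left to right: with $u_i=|f_1\cdots f_{i-1}|+1$ and $p_i=\max_{1\le j<u_i}\mathsf{lcp}(S[u_i..],S[j..u_i-1])$ ($p_i=0$ if $i=1$), set $f_i=S[u_i..\min\{u_i+p_i,|S|\}]$. Its size $\mathsf{zn}(S)$ is the number of factors. Self-referencing LZ77: $\mathsf{LZS}(S)$ is the factorization $S=g_1\cdots g_{z'}$ defined greedily from left to right: with $v_i=|g_1\cdots g_{i-1}|+1$ and $q_i=\max_{1\le j<v_i}\mathsf{lcp}(S[v_i..],S[j..])$ ($q_i=0$ if $i=1$), set $g_i=S[v_i..\min\{v_i+q_i,|S|\}]$.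 Its size $\mathsf{zs}(S)$ is the number of factors. *)

theory Defs
  imports Complex_Main "HOL-Library.Sublist"
begin

text \<open>
  Positions in strings are 1-based. The positions passed to \<open>substr\<close> below are always at
  least 1; \<open>substr S i j\<close> is empty if \<open>j < i\<close>.
  Strings over arbitrary finite alphabets are covered by taking \<open>nat\<close> as letter type: a list
  has finitely many letters, and every finite alphabet embeds into \<open>nat\<close>.
\<close>

definition substr :: "'a list \<Rightarrow> nat \<Rightarrow> nat \<Rightarrow> 'a list" where
  "substr S i j = take (j + 1 - i) (drop (i - 1) S)"

definition lcp :: "'a list \<Rightarrow> 'a list \<Rightarrow> nat" where
  "lcp X Y = length (longest_common_prefix X Y)"

definition monotonic :: "('a list \<Rightarrow> nat) \<Rightarrow> bool" where
  "monotonic A \<longleftrightarrow>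
     (\<forall>S. (\<forall>j. 1 \<le> j \<and> j < length S \<longrightarrow> A (substr S 1 j) \<le> A S) \<and>
          (\<forall>i. 1 < i \<and> i \<le> length S \<longrightarrow> A (substr S i (length S)) \<le> A S))"

text \<open>
  \<open>greedy_factors p S u\<close> factorizes the part of \<open>S\<close> that starts at position \<open>u\<close>. A factor that
  starts at \<open>u\<close> consists of a previously occurring string of length \<open>p S u\<close> and one further
  letter, and is cut off at the end of \<open>S\<close>.
\<close>

function greedy_factors :: "('a list \<Rightarrow> nat \<Rightarrow> nat) \<Rightarrow> 'a list \<Rightarrow> nat \<Rightarrow> 'a list list" where
  "greedy_factors p S u =
     (if length S < u then []
      else let e = min (u + p S u) (length S) in substr S u e # greedy_factors p S (e + 1))"
  by pat_completeness auto
termination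
  by (relation "measure (\<lambda>(p, S, u). length S + 1 - u)") auto

declare greedy_factors.simps [simp del]

definition lzn_len :: "'a list \<Rightarrow> nat \<Rightarrow> nat" where
  "lzn_len S u =
     (if u = 1 then 0
      else Max ((\<lambda>j. lcp (substr S u (length S)) (substr S j (u - 1))) ` {1..<u}))"

definition lzs_len :: "'a list \<Rightarrow> nat \<Rightarrow> nat" where
  "lzs_len S u =
     (if u = 1 then 0
      else Max ((\<lambda>j. lcp (substr S u (length S)) (substr S j (length S))) ` {1..<u}))"

definition LZN :: "'a list \<Rightarrow> 'a list list" where
  "LZN S = greedy_factors lzn_len S 1"

definition LZS :: "'a list \<Rightarrow> 'a list list" where
  "LZS S = greedy_factors lzs_len S 1"

definition zn :: "'a list \<Rightarrow> nat" where
  "zn S = length (LZN S)"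

definition zs :: "'a list \<Rightarrow> nat" where
  "zs S = length (LZS S)"

lemma concat_greedy_factors: "1 \<le> u \<Longrightarrow> concat (greedy_factors p S u) = drop (u - 1) S"
proof (induction p S u rule: greedy_factors.induct)
  case (1 p S u)
  show ?case
  proof (cases "length S < u")
    case True
    then show ?thesis by (simp add: greedy_factors.simps)
  next
    case False
    define e where "e = min (u + p S u) (length S)"
    have e: "u \<le> e" using False by (simp add: e_def)
    have "concat (greedy_factors p S u) = substr S u e @ concat (greedy_factors p S (e + 1))"
      using False by (subst greedy_factors.simps) (simp add: e_def Let_def)
    also have "concat (greedy_factors p S (e + 1)) = drop e S"
      using "1.IH"[OF False e_def] by simp
    also have "drop e S = drop (e + 1 - u) (drop (u - 1) S)"
      using e 1(2) by simp
    finally show ?thesis by (simp only: substr_def append_take_drop_id)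
  qed
qed

lemma concat_LZN: "concat (LZN S) = S" and concat_LZS: "concat (LZS S) = S"
  by (simp_all add: LZN_def LZS_def concat_greedy_factors)

end

theory Submission
  imports Defs
begin

text \<open>
  Deleting the first letter of \<open>aabaaa\<close> turns its factorization \<open>a|ab|aaa\<close> into
  \<open>a|b|aa|a\<close>, both with and without self-references: the initial \<open>aa\<close>, from which
  the last phrase \<open>aaa\<close> copies, is gone.
\<close>

text \<open>Only suffixes can refute monotonicity here: cutting letters off the end merely truncates
  a greedy factorization.\<close>

lemma not_monotonicI_suffix:
  assumes "1 < i" "i \<le> length S" "A S < A (substr S i (length S))"
  shows "\<not> monotonic A"
  using assms unfolding monotonic_def by (meson not_le)

theorem corollary1:
  shows "\<not> monotonic (zn :: nat list \<Rightarrow> nat) \<and> \<not> monotonic (zs :: nat list \<Rightarrow> nat)"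
proof
  let ?S = "[0, 0, 1, 0, 0, 0] :: nat list"
  show "\<not> monotonic (zn :: nat list \<Rightarrow> nat)"
  proof (rule not_monotonicI_suffix)
    \<comment> \<open>This evaluates to \<open>3 < 4\<close>.\<close>
    show "zn ?S < zn (substr ?S 2 (length ?S))" by code_simp
  qed simp_all
  show "\<not> monotonic (zs :: nat list \<Rightarrow> nat)"
  proof (rule not_monotonicI_suffix)
    \<comment> \<open>Again \<open>3 < 4\<close>. Overlap gains nothing: where the run
      \<open>aaa\<close> of \<open>abaaa\<close> begins, every earlier source starts with
      \<open>ab\<close> or \<open>b\<close>, so at most one letter matches.\<close>
    show "zs ?S < zs (substr ?S 2 (length ?S))" by code_simp
  qed simp_all
qed

end
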